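(* Let $n\ge 4$ be an integer and let $C_n$ be the cycle on $n$ vertices. Then $C_{tr}(C_n)=4$ if $n\equiv 0 \pmod 4$, and $C_{tr}(C_n)=3$ otherwise.
   Context: A set $S\subseteq V$ is a total restrained dominating set (TRD-set) of $G=(V,E)$ if every vertex of $V\setminus S$ is adjacent to at least one vertex of $S$ and to at least one other vertex of $V\setminus S$, and every vertex of $S$ is adjacent to at least one other vertex of $S$. Two disjoint sets $X,Y\subseteq V$ form a total restrained coalition if neither is a TRD-set but $X\cup Y$ is a TRD-set. A trc-partition of $G$ is a partition $\Phi$ of $V$ such that no member of $\Phi$ is a TRD-set and each member forms a total restrained coalition with some other member of $\Phi$. $C_{tr}(G)$ is the maximum cardinality of a trc-partition of $G$. *)

theory Defs
  imports "HOL-Library.Disjoint_Sets"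
begin

text \<open>
  A finite simple graph is given by its vertex set \<open>V\<close> and its set \<open>E\<close> of edges, each edge
  being a two-element subset of \<open>V\<close>.
\<close>

definition simple_graph :: "'a set \<Rightarrow> 'a set set \<Rightarrow> bool" where
  "simple_graph V E \<longleftrightarrow> finite V \<and> (\<forall>e\<in>E. e \<subseteq> V \<and> card e = 2)"

definition adjacent :: "'a set set \<Rightarrow> 'a \<Rightarrow> 'a \<Rightarrow> bool" where
  "adjacent E u v \<longleftrightarrow> {u, v} \<in> E"

definition trd_set :: "'a set \<Rightarrow> 'a set set \<Rightarrow> 'a set \<Rightarrow> bool" where
  "trd_set V E S \<longleftrightarrow> S \<subseteq> V
     \<and> (\<forall>v\<in>V - S. (\<exists>u\<in>S. adjacent E v u) \<and> (\<exists>w\<in>V - S. w \<noteq> v \<and> adjacent E v w))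
     \<and> (\<forall>v\<in>S. \<exists>u\<in>S. u \<noteq> v \<and> adjacent E v u)"

definition tr_coalition :: "'a set \<Rightarrow> 'a set set \<Rightarrow> 'a set \<Rightarrow> 'a set \<Rightarrow> bool" where
  "tr_coalition V E X Y \<longleftrightarrow> X \<subseteq> V \<and> Y \<subseteq> V \<and> X \<inter> Y = {}
     \<and> \<not> trd_set V E X \<and> \<not> trd_set V E Y \<and> trd_set V E (X \<union> Y)"

definition trc_partition :: "'a set \<Rightarrow> 'a set set \<Rightarrow> 'a set set \<Rightarrow> bool" where
  "trc_partition V E P \<longleftrightarrow> partition_on V P
     \<and> (\<forall>X\<in>P. \<not> trd_set V E X)
     \<and> (\<forall>X\<in>P. \<exists>Y\<in>P. Y \<noteq> X \<and> tr_coalition V E X Y)"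

text \<open>
  For finite \<open>V\<close> the maximum ranges over a finite set; it is unspecified if the graph
  has no trc-partition at all.
\<close>

definition C_tr :: "'a set \<Rightarrow> 'a set set \<Rightarrow> nat" where
  "C_tr V E = Max (card ` {P. trc_partition V E P})"

definition cycle_verts :: "nat \<Rightarrow> nat set" where
  "cycle_verts n = {0..<n}"

text \<open>This is the cycle graph only for \<open>n \<ge> 3\<close>.\<close>

definition cycle_edges :: "nat \<Rightarrow> nat set set" where
  "cycle_edges n = {{i, (i + 1) mod n} | i. i < n}"

lemma simple_graph_cycle:
  assumes "n \<ge> 3"
  shows "simple_graph (cycle_verts n) (cycle_edges n)"
proof -
  have "(i + 1) mod n < n \<and> i \<noteq> (i + 1) mod n" if "i < n" for i
    using assms that by (cases "i + 1 = n") auto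
  then show ?thesis
    by (auto simp: simple_graph_def cycle_verts_def cycle_edges_def card_2_iff)
qed

lemma finite_trc_partitions:
  assumes "simple_graph V E"
  shows "finite {P. trc_partition V E P}"
proof (rule finite_subset)
  show "{P. trc_partition V E P} \<subseteq> Pow (Pow V)"
    by (auto simp: trc_partition_def partition_on_def)
  show "finite (Pow (Pow V))"
    using assms by (simp add: simple_graph_def)
qed

end

theory Submission
  imports Defs
begin

text \<open>
  On a cycle every vertex has only two neighbours, and a TRD-set contains at least one of them.
  If a trc-partition has two disjoint coalition pairs \<open>A\<close>, \<open>B\<close> and \<open>C\<close>, \<open>D\<close>, then each of
  \<open>A \<union> B\<close> and \<open>C \<union> D\<close> contains exactly one neighbour of every vertex; hence there are no further
  classes, and membership in \<open>A \<union> B\<close> flips under a shift by two, which forces \<open>4\<close> to divide \<open>n\<close>.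
  If there are no two disjoint coalition pairs and at least four classes, one class \<open>X\<close> is a
  partner of all the others. Three disjoint partners of \<open>X\<close> cannot all meet a two-element
  neighbourhood outside \<open>X\<close>, so \<open>X\<close> is itself a TRD-set, a contradiction.
\<close>

section \<open>TRD-sets in graphs of maximum degree two\<close>

lemma adjacent_commute: "adjacent E u v \<longleftrightarrow> adjacent E v u"
  by (simp add: adjacent_def insert_commute)

lemma trd_set_dominates:
  assumes "trd_set V E S" "v \<in> V"
  obtains u where "u \<in> S" "adjacent E v u"
  using assms unfolding trd_set_def by blast

lemma tr_coalition_commute: "tr_coalition V E X Y \<longleftrightarrow> tr_coalition V E Y X"
  by (auto simp: tr_coalition_def Un_commute Int_commute)

text \<open>The pair \<open>a\<close>, \<open>b\<close> stands in for a bound on a cardinality: the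
  two may coincide and need not be neighbours of \<open>v\<close>.\<close>

definition max_degree_two :: "'a set \<Rightarrow> 'a set set \<Rightarrow> bool" where
  "max_degree_two V E \<longleftrightarrow> (\<forall>v\<in>V. \<exists>a b. \<forall>u. adjacent E v u \<longrightarrow> u = a \<or> u = b)"

lemma max_degree_two_pigeonhole:
  assumes "max_degree_two V E" "v \<in> V" "adjacent E v x" "adjacent E v y" "adjacent E v z"
  shows "x = y \<or> x = z \<or> y = z"
  using assms unfolding max_degree_two_def by blast

text \<open>A simple graph has no loops, so a neighbour is automatically another vertex, and the two
  domination clauses merge into one over all of \<open>V\<close>.\<close>

lemma trd_setI:
  assumes graph: "simple_graph V E" and "S \<subseteq> V"
    and inside: "\<And>v. v \<in> V \<Longrightarrow> \<exists>u\<in>S. adjacent E v u"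
    and outside: "\<And>v. v \<in> V - S \<Longrightarrow> \<exists>w\<in>V - S. adjacent E v w"
  shows "trd_set V E S"
proof -
  have "u \<noteq> v" if "adjacent E v u" for u v
    using graph that by (auto simp: simple_graph_def adjacent_def)
  with assms(2-) show ?thesis unfolding trd_set_def by (meson DiffD1 subsetD)
qed

lemma trd_set_of_three_partners:
  assumes graph: "simple_graph V E" and deg: "max_degree_two V E"
    and trd: "trd_set V E (X \<union> A)" "trd_set V E (X \<union> B)" "trd_set V E (X \<union> C)"
    and disj: "A \<inter> B = {}" "A \<inter> C = {}" "B \<inter> C = {}"
  shows "trd_set V E X"
proof (rule trd_setI[OF graph])
  show "X \<subseteq> V" using trd(1) by (simp add: trd_set_def)
  show "\<exists>u\<in>X. adjacent E v u" if v: "v \<in> V" for v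
  proof (rule ccontr)
    assume none: "\<not> ?thesis"
    obtain x y z where "x \<in> A" "adjacent E v x" "y \<in> B" "adjacent E v y" "z \<in> C" "adjacent E v z"
      using trd[THEN trd_set_dominates, OF v] none by (metis Un_iff)
    with max_degree_two_pigeonhole[OF deg v] disj show False by blast
  qed
  show "\<exists>w\<in>V - X. adjacent E v w" if v: "v \<in> V - X" for v
  proof -
    \<comment> \<open>Restraint passes down to \<open>X\<close>: a neighbour outside one of the
      larger unions is also outside \<open>X\<close>.\<close>
    from v disj(1) have "v \<in> V - (X \<union> A) \<or> v \<in> V - (X \<union> B)" by blast
    with trd(1,2) show ?thesis unfolding trd_set_def by blast
  qed
qed

text \<open>The neighbours of \<open>v\<close> supplied by \<open>S\<close> and \<open>T\<close> are
  distinct, so they are \<open>a\<close> and \<open>b\<close> in some order.\<close>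

lemma max_degree_two_disjoint_trd_sets:
  assumes "max_degree_two V E" "v \<in> V" "trd_set V E S" "trd_set V E T" "S \<inter> T = {}"
    and "adjacent E v a" "adjacent E v b" "a \<noteq> b"
  shows "a \<in> S \<longleftrightarrow> b \<in> T"
proof -
  obtain s t where "s \<in> S" "adjacent E v s" "t \<in> T" "adjacent E v t"
    using assms(2-4) by (meson trd_set_dominates)
  moreover from this have "s \<noteq> t" using assms(5) by blast
  ultimately have "s = a \<and> t = b \<or> s = b \<and> t = a"
    using max_degree_two_pigeonhole[OF assms(1,2)] assms(6-8) by metis
  with \<open>s \<in> S\<close> \<open>t \<in> T\<close> assms(5) show ?thesis by blast
qed

text \<open>Look at \<open>z\<close> from one of its neighbours \<open>v\<close>: the neighbours of
  \<open>v\<close> in \<open>S\<close> and in \<open>T\<close> are already two, so \<open>z\<close>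
  is one of them.\<close>

lemma disjoint_trd_sets_cover:
  assumes graph: "simple_graph V E" and deg: "max_degree_two V E"
    and trd: "trd_set V E S" "trd_set V E T" and disj: "S \<inter> T = {}"
  shows "S \<union> T = V"
proof
  show "S \<union> T \<subseteq> V" using trd by (auto simp: trd_set_def)
  show "V \<subseteq> S \<union> T"
  proof
    fix z assume "z \<in> V"
    then obtain v where "v \<in> S" "adjacent E z v" using trd(1) by (metis trd_set_dominates)
    then have v: "v \<in> V" "adjacent E v z"
      using trd(1) \<open>adjacent E z v\<close> adjacent_commute[of E z v] unfolding trd_set_def by blast+
    obtain s t where "s \<in> S" "adjacent E v s" "t \<in> T" "adjacent E v t"
      using trd v(1) by (meson trd_set_dominates)
    with max_degree_two_pigeonhole[OF deg v(1) v(2)] disj show "z \<in> S \<union> T" by blast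
  qed
qed

section \<open>Coalition structure of partitions with at least four classes\<close>

text \<open>Read \<open>R\<close> as a graph without isolated vertices in which any two edges meet.
  Every vertex off an edge \<open>ab\<close> is then joined to \<open>a\<close> or \<open>b\<close>.
  If \<open>c\<close> is joined only to \<open>b\<close> and \<open>d\<close> only to
  \<open>a\<close>, the edges \<open>bc\<close> and \<open>ad\<close> are disjoint; hence
  \<open>a\<close> or \<open>b\<close> is joined to all others.\<close>

lemma two_disjoint_edges_or_star:
  assumes sym: "\<And>x y. R x y \<Longrightarrow> R y x"
    and partner: "\<And>x. x \<in> P \<Longrightarrow> \<exists>y\<in>P. y \<noteq> x \<and> R x y"
    and "P \<noteq> {}"
  shows "(\<exists>a\<in>P. \<exists>b\<in>P. \<exists>c\<in>P. \<exists>d\<in>P. distinct [a, b, c, d] \<and> R a b \<and> R c d) \<or>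
         (\<exists>x\<in>P. \<forall>y\<in>P - {x}. R x y)"
proof (cases "\<exists>a\<in>P. \<exists>b\<in>P. \<exists>c\<in>P. \<exists>d\<in>P. distinct [a, b, c, d] \<and> R a b \<and> R c d")
  case False
  then have meet: "{a, b} \<inter> {c, d} \<noteq> {}"
    if "a \<in> P" "b \<in> P" "c \<in> P" "d \<in> P" "a \<noteq> b" "c \<noteq> d" "R a b" "R c d" for a b c d
    using that by auto
  obtain a b where ab: "a \<in> P" "b \<in> P" "b \<noteq> a" "R a b" using \<open>P \<noteq> {}\<close> partner by blast
  have to_edge: "R a c \<or> R b c" if c: "c \<in> P - {a, b}" for c
  proof -
    from c partner obtain d where "d \<in> P" "d \<noteq> c" "R c d" by blast
    with meet[of a b c d] ab c sym show ?thesis by auto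
  qed
  show ?thesis
  proof (cases "\<forall>c\<in>P - {a}. R a c")
    case False
    then obtain c where c: "c \<in> P - {a, b}" "\<not> R a c" "R b c" using ab to_edge by blast
    have "R b d" if "d \<in> P - {b}" for d
    proof (rule ccontr)
      assume "\<not> R b d"
      with that c ab sym to_edge have "d \<in> P - {a, b, c}" "R a d" by blast+
      with meet[of b c a d] ab c show False by auto
    qed
    with ab show ?thesis by blast
  qed (use ab in blast)
qed blast

text \<open>\<open>S\<close> and \<open>T\<close> are the unions of two disjoint coalition pairs.
  They are handed on because they carry the divisibility information on a cycle.\<close>

lemma trc_partition_card_ge_4:
  assumes graph: "simple_graph V E" and deg: "max_degree_two V E"
    and part: "trc_partition V E P" and card: "card P \<ge> 4"
  obtains S T where "trd_set V E S" "trd_set V E T" "S \<inter> T = {}" "card P = 4"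
proof -
  have disj: "X \<inter> Y = {}" if "X \<in> P" "Y \<in> P" "X \<noteq> Y" for X Y
    using part that by (auto simp: trc_partition_def partition_on_def disjoint_def)
  have P: "\<Union> P = V" "{} \<notin> P"
    using part by (auto simp: trc_partition_def partition_on_def)
  have "P \<noteq> {}" using card by auto
  have "(\<exists>A\<in>P. \<exists>B\<in>P. \<exists>C\<in>P. \<exists>D\<in>P. distinct [A, B, C, D] \<and> tr_coalition V E A B \<and> tr_coalition V E C D) \<or>
      (\<exists>X\<in>P. \<forall>Y\<in>P - {X}. tr_coalition V E X Y)"
    using tr_coalition_commute[of V E] part \<open>P \<noteq> {}\<close>
    by (intro two_disjoint_edges_or_star) (simp_all add: trc_partition_def)
  then show thesis
  proof (elim disjE bexE conjE)
    fix A B C D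
    assume 1: "A \<in> P" "B \<in> P" "C \<in> P" "D \<in> P" "distinct [A, B, C, D]"
      "tr_coalition V E A B" "tr_coalition V E C D"
    let ?S = "A \<union> B" and ?T = "C \<union> D"
    have trd: "trd_set V E ?S" "trd_set V E ?T"
      using 1 by (auto simp: tr_coalition_def)
    have ST: "?S \<inter> ?T = {}" using 1 disj by (simp add: Int_Un_distrib Int_Un_distrib2)
    have V: "?S \<union> ?T = V" by (rule disjoint_trd_sets_cover[OF graph deg trd ST])
    have "P = {A, B, C, D}"
    proof
      show "P \<subseteq> {A, B, C, D}"
      proof
        fix Z assume Z: "Z \<in> P"
        with P(2) obtain z where z: "z \<in> Z" by (metis ex_in_conv)
        with Z P(1) V have "z \<in> A \<union> B \<union> C \<union> D" by blast
        with z disj[OF Z] 1(1-4) show "Z \<in> {A, B, C, D}" by blast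
      qed
    qed (use 1 in simp)
    with 1(5) have "card P = 4" by simp
    with trd ST show thesis by (rule that)
  next
    fix X
    assume 2: "X \<in> P" "\<forall>Y\<in>P - {X}. tr_coalition V E X Y"
    have "card (P - {X}) \<ge> 3" using card 2(1) by (simp add: card_Diff_singleton)
    then obtain Q where "Q \<subseteq> P - {X}" "card Q = 3" by (rule obtain_subset_with_card_n)
    then obtain A B C where Q: "{A, B, C} \<subseteq> P - {X}" "A \<noteq> B" "A \<noteq> C" "B \<noteq> C"
      by (auto simp: card_3_iff)
    have "trd_set V E X"
      using 2(2) Q disj[of A B] disj[of A C] disj[of B C]
      by (intro trd_set_of_three_partners[OF graph deg, of X A B C])
        (auto simp: tr_coalition_def)
    with part 2(1) show thesis by (auto simp: trc_partition_def)
  qed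
qed

section \<open>Disjoint TRD-sets on a cycle\<close>

lemma adjacent_cycle_iff:
  "adjacent (cycle_edges n) u v \<longleftrightarrow> u < n \<and> v < n \<and> (v = Suc u mod n \<or> u = Suc v mod n)"
  by (auto simp: adjacent_def cycle_edges_def doubleton_eq_iff)

lemma Suc_mod_inj:
  fixes u v n :: nat
  assumes "u < n" "v < n" "Suc u mod n = Suc v mod n"
  shows "u = v"
  using assms by (auto simp: mod_Suc split: if_splits)

lemma max_degree_two_cycle: "max_degree_two (cycle_verts n) (cycle_edges n)"
  unfolding max_degree_two_def
proof
  fix v
  \<comment> \<open>The second candidate is the cyclic predecessor. If there is none, the value of
    the description is irrelevant, since no neighbour is then of that kind.\<close>
  have "\<forall>u. adjacent (cycle_edges n) v u \<longrightarrow> u = Suc v mod n \<or> u = (THE u. u < n \<and> v = Suc u mod n)"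
    by (auto simp: adjacent_cycle_iff intro!: the_equality[symmetric] dest: Suc_mod_inj)
  then show "\<exists>a b. \<forall>u. adjacent (cycle_edges n) v u \<longrightarrow> u = a \<or> u = b"
    by blast
qed

lemma disjoint_trd_sets_cycle:
  assumes n: "n \<ge> 3"
    and trd: "trd_set (cycle_verts n) (cycle_edges n) S" "trd_set (cycle_verts n) (cycle_edges n) T"
    and disj: "S \<inter> T = {}"
  shows "4 dvd n"
proof -
  have cover: "S \<union> T = cycle_verts n"
    using simple_graph_cycle[OF n] max_degree_two_cycle trd disj
    by (rule disjoint_trd_sets_cover)
  \<comment> \<open>An \<open>n\<close>-periodic version of membership in \<open>S\<close>, so that
    shifts may run past the end of the cycle.\<close>
  define f where "f i \<longleftrightarrow> i mod n \<in> S" for i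
  \<comment> \<open>\<open>i\<close> and \<open>i + 2\<close> are the neighbours of
    \<open>i + 1\<close>, distinct because \<open>n \<ge> 3\<close>, so one lies in \<open>S\<close>
    and the other in \<open>T\<close>.\<close>
  have step: "f (i + 2) \<longleftrightarrow> \<not> f i" for i
  proof -
    have "i mod n < n" "(i + 1) mod n < n" "(i + 2) mod n < n" using n by auto
    moreover have "Suc (i mod n) mod n = (i + 1) mod n" "Suc ((i + 1) mod n) mod n = (i + 2) mod n"
      by (simp_all add: mod_Suc_eq)
    moreover have "i mod n \<noteq> (i + 2) mod n"
      using n by (auto simp: mod_Suc split: if_splits)
    ultimately have "i mod n \<in> S \<longleftrightarrow> (i + 2) mod n \<in> T"
      by (intro max_degree_two_disjoint_trd_sets[OF max_degree_two_cycle _ trd disj, of "(i + 1) mod n"])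
        (auto simp: adjacent_cycle_iff cycle_verts_def)
    moreover have "(i + 2) mod n \<in> S \<union> T" using n by (simp add: cover cycle_verts_def)
    ultimately show ?thesis using disj by (auto simp: f_def)
  qed
  have iterate: "f (2 * m) \<longleftrightarrow> (f 0 \<longleftrightarrow> even m)" for m
    by (induction m) (use step in \<open>auto simp: add.commute\<close>)
  \<comment> \<open>\<open>n\<close> shifts by two go round the cycle twice, so \<open>n\<close> is
    even; then \<open>n / 2\<close> shifts go round once, so \<open>n / 2\<close> is even
    too.\<close>
  from iterate[of n] have "even n" by (cases "0 \<in> S") (simp_all add: f_def)
  then obtain m where m: "n = 2 * m" by blast
  with iterate[of m] have "even m" by (cases "0 \<in> S") (simp_all add: f_def)
  with m show ?thesis by auto
qed

section \<open>Partitions attaining the bounds\<close>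

text \<open>The neighbours of a vertex have residues differing by two modulo 4. Two consecutive
  residues contain exactly one of them, and so do the two remaining residues.\<close>

lemma trd_set_residues_mod_4:
  assumes n: "n \<ge> 3" "4 dvd n"
  shows "trd_set (cycle_verts n) (cycle_edges n) {i. i < n \<and> (i mod 4 = r mod 4 \<or> i mod 4 = Suc r mod 4)}"
    (is "trd_set _ _ ?S")
proof -
  \<comment> \<open>A general \<open>P\<close> lets this fact serve both domination and restraint;
    \<open>v + 3\<close> stands for \<open>v - 1\<close> modulo 4.\<close>
  have nbrs: "\<exists>u<n. P (u mod 4) \<and> adjacent (cycle_edges n) v u"
    if v: "v < n" and P: "P (Suc v mod 4) \<or> P ((v + 3) mod 4)" for v P
  proof -
    define a where "a = Suc v mod n"
    \<comment> \<open>The cyclic predecessor, written so that subtraction does not truncate at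
      \<open>v = 0\<close>.\<close>
    define b where "b = (v + (n - 1)) mod n"
    have b: "Suc b mod n = v" using v by (simp add: b_def mod_Suc_eq)
    then have "Suc b mod 4 = v mod 4" using n by (metis mod_mod_cancel)
    then have "b mod 4 = (v + 3) mod 4" by presburger
    moreover have "a mod 4 = Suc v mod 4" using n by (simp add: a_def mod_mod_cancel)
    moreover have "a < n" "b < n" using v by (simp_all add: a_def b_def)
    moreover from this have "adjacent (cycle_edges n) v a" "adjacent (cycle_edges n) v b"
      using v b by (simp_all add: adjacent_cycle_iff a_def)
    ultimately show ?thesis using P by metis
  qed
  have residues: "k mod 4 = 0 \<or> k mod 4 = 1 \<or> k mod 4 = 2 \<or> k mod 4 = 3" for k :: nat
    by presburger
  have pred_mod: "(v + 3) mod 4 = (if v mod 4 = 0 then 3 else v mod 4 - 1)" for v :: nat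
    by presburger
  show ?thesis
  proof (rule trd_setI[OF simple_graph_cycle[OF n(1)]])
    show "?S \<subseteq> cycle_verts n" by (auto simp: cycle_verts_def)
  next
    fix v assume v: "v \<in> cycle_verts n"
    let ?P = "\<lambda>k. k = r mod 4 \<or> k = Suc r mod 4"
    have "?P (Suc v mod 4) \<or> ?P ((v + 3) mod 4)"
      using residues[of v] residues[of r] by (elim disjE) (simp_all add: mod_Suc pred_mod)
    with nbrs[of v ?P] v show "\<exists>u\<in>?S. adjacent (cycle_edges n) v u"
      by (auto simp: cycle_verts_def)
  next
    fix v assume v: "v \<in> cycle_verts n - ?S"
    let ?P = "\<lambda>k. \<not> (k = r mod 4 \<or> k = Suc r mod 4)"
    have "?P (v mod 4)" using v by (auto simp: cycle_verts_def)
    then have "?P (Suc v mod 4) \<or> ?P ((v + 3) mod 4)"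
      using residues[of v] residues[of r] by (elim disjE) (simp_all add: mod_Suc pred_mod)
    with nbrs[of v ?P] v show "\<exists>w\<in>cycle_verts n - ?S. adjacent (cycle_edges n) v w"
      by (auto simp: cycle_verts_def)
  qed
qed

lemma trc_partition_mod_4:
  assumes "n > 0" "4 dvd n"
  shows "\<exists>P. trc_partition (cycle_verts n) (cycle_edges n) P \<and> card P = 4"
proof -
  define C where "C r = {i. i < n \<and> i mod 4 = r}" for r
  have n: "n \<ge> 4" using assms by (simp add: dvd_imp_le)
  have mem: "r \<in> C r" if "r < 4" for r using that n by (simp add: C_def)
  have disj: "C r \<inter> C s = {}" if "r \<noteq> s" for r s using that by (auto simp: C_def)
  have inj: "inj_on C {..<4}"
    using mem disj by (metis (no_types) disjoint_iff inj_onI lessThan_iff)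
  \<comment> \<open>Adjacent vertices have different residues, so the vertex \<open>r\<close> has no
    neighbour in its own class.\<close>
  have not_trd: "\<not> trd_set (cycle_verts n) (cycle_edges n) (C r)" if "r < 4" for r
  proof
    assume "trd_set (cycle_verts n) (cycle_edges n) (C r)"
    moreover have "r \<in> cycle_verts n" using that n by (simp add: cycle_verts_def)
    ultimately obtain u where "u \<in> C r" "adjacent (cycle_edges n) r u" by (rule trd_set_dominates)
    then have u: "u mod 4 = r mod 4" "u = Suc r mod n \<or> r = Suc u mod n"
      using that by (auto simp: C_def adjacent_cycle_iff)
    from u(2) assms(2) have "u mod 4 = Suc r mod 4 \<or> r mod 4 = Suc u mod 4"
      by (auto simp: mod_mod_cancel)
    with u(1) show False by (auto simp: mod_Suc split: if_splits)
  qed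
  have coalition: "tr_coalition (cycle_verts n) (cycle_edges n) (C r) (C (Suc r))" if "Suc r < 4" for r
  proof -
    have "C r \<union> C (Suc r) = {i. i < n \<and> (i mod 4 = r mod 4 \<or> i mod 4 = Suc r mod 4)}"
      using that by (auto simp: C_def)
    with trd_set_residues_mod_4[OF _ assms(2), of r] n
    have "trd_set (cycle_verts n) (cycle_edges n) (C r \<union> C (Suc r))" by simp
    with that show ?thesis
      using not_trd disj by (auto simp: tr_coalition_def C_def cycle_verts_def)
  qed
  have "partition_on (cycle_verts n) (C ` {..<4})"
  proof (rule partition_onI)
    show "\<Union> (C ` {..<4}) = cycle_verts n" by (auto simp: C_def cycle_verts_def)
    show "disjnt p q" if "p \<in> C ` {..<4}" "q \<in> C ` {..<4}" "p \<noteq> q" for p q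
    proof -
      from that obtain r s where "p = C r" "q = C s" "r \<noteq> s" by auto
      with disj[of r s] show ?thesis by (simp add: disjnt_def)
    qed
    show "{} \<notin> C ` {..<4}"
    proof
      assume "{} \<in> C ` {..<4}"
      then obtain r where "C r = {}" "r < 4" by auto
      with mem[of r] show False by simp
    qed
  qed
  moreover have "\<exists>s\<in>{..<4}. C s \<noteq> C r \<and> tr_coalition (cycle_verts n) (cycle_edges n) (C r) (C s)" if "r < 4" for r
  proof -
    \<comment> \<open>Pairing 0 with 1 and 2 with 3 avoids the wrap-around from residue 3 to
      0.\<close>
    define s where "s = (if even r then Suc r else r - 1)"
    have s: "s < 4" "s \<noteq> r" using that unfolding s_def by presburger+
    moreover have "tr_coalition (cycle_verts n) (cycle_edges n) (C r) (C s)"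
    proof (cases "even r")
      case True
      with s coalition[of r] show ?thesis by (simp add: s_def)
    next
      case False
      then have "Suc s = r" by (auto simp: s_def elim!: oddE)
      with that coalition[of s] show ?thesis by (simp add: tr_coalition_commute)
    qed
    moreover have "C s \<noteq> C r" using inj s that by (simp add: inj_on_eq_iff)
    ultimately show ?thesis using s(1) by blast
  qed
  ultimately have "trc_partition (cycle_verts n) (cycle_edges n) (C ` {..<4})"
    using not_trd by (auto simp: trc_partition_def)
  moreover have "card (C ` {..<4}) = 4" using inj by (simp add: card_image)
  ultimately show ?thesis by blast
qed

text \<open>The long path joined with either short one is a cyclic path whose complement is a single
  edge: each end of that edge is adjacent to the other and to an end of the path. The bound on
  \<open>n\<close> keeps the long path nonempty.\<close>

lemma trc_partition_three_paths:
  assumes "n \<ge> 5"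
  shows "trc_partition (cycle_verts n) (cycle_edges n) {{0..<n - 4}, {n - 4, n - 3}, {n - 2, n - 1}}"
    (is "trc_partition ?V ?E {?A, ?B, ?C}")
proof -
  have adj: "adjacent ?E u v \<longleftrightarrow>
      u < n \<and> v < n \<and> (v = Suc u \<or> u = Suc v \<or> u = 0 \<and> v = n - 1 \<or> v = 0 \<and> u = n - 1)" for u v
    using assms by (auto simp: adjacent_cycle_iff mod_Suc)
  \<comment> \<open>Each class misses both neighbours of a chosen vertex: \<open>n - 2\<close>,
    \<open>n - 1\<close> and \<open>n - 4\<close> respectively.\<close>
  have not_trd: "\<not> trd_set ?V ?E ?A" "\<not> trd_set ?V ?E ?B" "\<not> trd_set ?V ?E ?C"
  proof -
    show "\<not> trd_set ?V ?E ?A"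
    proof
      assume "trd_set ?V ?E ?A"
      moreover have "n - 2 \<in> ?V" using assms by (simp add: cycle_verts_def)
      ultimately obtain u where "u \<in> ?A" "adjacent ?E (n - 2) u" by (rule trd_set_dominates)
      with assms show False by (auto simp: adj)
    qed
    show "\<not> trd_set ?V ?E ?B"
    proof
      assume "trd_set ?V ?E ?B"
      moreover have "n - 1 \<in> ?V" using assms by (simp add: cycle_verts_def)
      ultimately obtain u where "u \<in> ?B" "adjacent ?E (n - 1) u" by (rule trd_set_dominates)
      with assms show False by (auto simp: adj)
    qed
    show "\<not> trd_set ?V ?E ?C"
    proof
      assume "trd_set ?V ?E ?C"
      moreover have "n - 4 \<in> ?V" using assms by (simp add: cycle_verts_def)
      ultimately obtain u where "u \<in> ?C" "adjacent ?E (n - 4) u" by (rule trd_set_dominates)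
      with assms show False by (auto simp: adj)
    qed
  qed
  have graph: "simple_graph ?V ?E" using assms by (simp add: simple_graph_cycle)
  have AB: "trd_set ?V ?E (?A \<union> ?B)"
  proof (rule trd_setI[OF graph])
    show "?A \<union> ?B \<subseteq> ?V" using assms by (auto simp: cycle_verts_def)
    show "\<exists>u\<in>?A \<union> ?B. adjacent ?E v u" if "v \<in> ?V" for v
    proof -
      \<comment> \<open>The predecessor works except at \<open>0\<close> and \<open>n - 1\<close>,
        where it falls into \<open>?C\<close>; there the successor is taken.\<close>
      let ?u = "if v = 0 then 1 else if v = n - 1 then 0 else v - 1"
      have "?u \<in> ?A \<union> ?B" "adjacent ?E v ?u"
        using assms that by (auto simp: adj cycle_verts_def)
      then show ?thesis by blast
    qed
    show "\<exists>w\<in>?V - (?A \<union> ?B). adjacent ?E v w" if "v \<in> ?V - (?A \<union> ?B)" for v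
    proof -
      have "v = n - 2 \<or> v = n - 1" using that by (auto simp: cycle_verts_def)
      then show ?thesis
        using assms by (intro bexI[of _ "if v = n - 2 then n - 1 else n - 2"]) (auto simp: adj cycle_verts_def)
    qed
  qed
  have AC: "trd_set ?V ?E (?A \<union> ?C)"
  proof (rule trd_setI[OF graph])
    show "?A \<union> ?C \<subseteq> ?V" using assms by (auto simp: cycle_verts_def)
    show "\<exists>u\<in>?A \<union> ?C. adjacent ?E v u" if "v \<in> ?V" for v
    proof -
      \<comment> \<open>The path now runs from \<open>n - 2\<close> through \<open>0\<close> to
        \<open>n - 5\<close>. The predecessor fails only at \<open>n - 3\<close> and
        \<open>n - 2\<close>; at \<open>0\<close> it is \<open>n - 1\<close>.\<close>
      let ?u = "if v = 0 then n - 1 else if v = n - 3 \<or> v = n - 2 then v + 1 else v - 1"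
      have "?u \<in> ?A \<union> ?C" "adjacent ?E v ?u"
        using assms that by (auto simp: adj cycle_verts_def)
      then show ?thesis by blast
    qed
    show "\<exists>w\<in>?V - (?A \<union> ?C). adjacent ?E v w" if "v \<in> ?V - (?A \<union> ?C)" for v
    proof -
      have "v = n - 4 \<or> v = n - 3" using that by (auto simp: cycle_verts_def)
      then show ?thesis
        using assms by (intro bexI[of _ "if v = n - 4 then n - 3 else n - 4"]) (auto simp: adj cycle_verts_def)
    qed
  qed
  have "partition_on ?V {?A, ?B, ?C}"
    using assms by (intro partition_onI) (auto simp: cycle_verts_def disjnt_def)
  moreover have coalitions: "tr_coalition ?V ?E ?A ?B" "tr_coalition ?V ?E ?A ?C"
    using assms AB AC not_trd by (auto simp: tr_coalition_def cycle_verts_def)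
  moreover have "tr_coalition ?V ?E ?B ?A" "tr_coalition ?V ?E ?C ?A"
    using coalitions by (simp_all only: tr_coalition_commute)
  moreover have "?A \<noteq> ?B" "?A \<noteq> ?C"
    using assms by auto
  ultimately show ?thesis
    using not_trd unfolding trc_partition_def by (metis insertCI insertE singletonD)
qed

theorem theorem3p10:
  fixes n :: nat
  assumes "n \<ge> 4"
  shows "C_tr (cycle_verts n) (cycle_edges n) = (if n mod 4 = 0 then 4 else 3)"
proof -
  let ?trc = "trc_partition (cycle_verts n) (cycle_edges n)"
  have graph: "simple_graph (cycle_verts n) (cycle_edges n)"
    using assms by (intro simple_graph_cycle) simp
  have upper: "card P \<le> (if n mod 4 = 0 then 4 else 3)" if P: "?trc P" for P
  proof (cases "card P \<ge> 4")
    case True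
    with graph max_degree_two_cycle P obtain S T
      where "trd_set (cycle_verts n) (cycle_edges n) S" "trd_set (cycle_verts n) (cycle_edges n) T"
        "S \<inter> T = {}" "card P = 4"
      by (rule trc_partition_card_ge_4)
    with disjoint_trd_sets_cycle[of n S T] assms show ?thesis by (simp add: mod_0_imp_dvd)
  qed simp
  have "\<exists>P. ?trc P \<and> card P = (if n mod 4 = 0 then 4 else 3)"
  proof (cases "n mod 4 = 0")
    case True
    with trc_partition_mod_4[of n] assms show ?thesis by auto
  next
    case False
    with assms have "n \<ge> 5" by (cases "n = 4") auto
    \<comment> \<open>The vertices \<open>n - 4\<close> and \<open>n - 2\<close> tell the three
      classes apart.\<close>
    moreover from this have "n - 4 \<noteq> n - 2" "n - 4 \<noteq> n - 1" "n - 4 \<notin> {0..<n - 4}" "n - 2 \<notin> {0..<n - 4}"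
      by auto
    then have "card {{0..<n - 4}, {n - 4, n - 3}, {n - 2, n - 1}} = 3"
      by (subst card_3_iff) blast
    ultimately show ?thesis using trc_partition_three_paths False by auto
  qed
  then show ?thesis
    unfolding C_tr_def using finite_trc_partitions[OF graph] upper
    by (intro Max_eqI) (auto simp del: if_split_asm)
qed

end
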